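(* For each $N\geq 2$ there is a constant $A(N)>0$ such that, whenever $\lambda/\theta>A(N)$, the bias voter model $\{\eta_t\}_{t\ge0}$ on $\mathbb{T}^N$ with parameters $\lambda>\theta>0$ and initial distribution $\mu_p$, for any $p\in(0,1)$, converges weakly as $t\to\infty$ to the point mass $\delta_{\mathbf 1}$ on the configuration in which every vertex is in state $1$. Moreover the constants satisfy \[ \limsup_{N\to\infty}\frac{A(N)}{\sqrt N}\le 1. \]
   Context: $\mathbb{T}^N$ denotes the infinite regular tree in which every vertex has degree $N+1$. For a connected graph $S$ with finite degrees and constants $\lambda>\theta>0$, the bias voter model on $S$ is the spin system $\{\eta_t\}_{t\ge0}$ on $\{0,1\}^S$ with flip rate at vertex $x$ in configuration $\eta$ equal to $\frac{\lambda}{\deg(x)}\sum_{y\sim x}\eta(y)$ if $\eta(x)=0$ and $\frac{\theta}{\deg(x)}\sum_{y\sim x}(1-\eta(y))$ if $\eta(x)=1$. $\mu_p$ denotes the product Bernoulli measure with density $p$ on $\{0,1\}^S$. Weak convergence $\eta_t\Rightarrow\mu$ means $E f(\eta_t)\to\int f\,d\mu$ for every continuous $f$ on $\{0,1\}^S$ (product topology). *)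

theory Defs
  imports "HOL-Probability.Probability"
begin

text \<open>The regular tree T^N (every vertex has degree N+1), realised as the Cayley
graph of the free product of N+1 copies of Z/2: vertices are finite words over
{0..N} with no two consecutive letters equal; a word is adjacent to its
one-letter extensions and to the word with its last letter removed.\<close>

definition tree_vert :: "nat \<Rightarrow> nat list set" where
  "tree_vert N = {xs. set xs \<subseteq> {..N} \<and> (\<forall>i. Suc i < length xs \<longrightarrow> xs ! i \<noteq> xs ! Suc i)}"

definition tree_nbrs :: "nat \<Rightarrow> nat list \<Rightarrow> nat list set" where
  "tree_nbrs N x = {y \<in> tree_vert N. (x \<noteq> [] \<and> y = butlast x) \<or> (y \<noteq> [] \<and> butlast y = x)}"

definition tree_deg :: "nat \<Rightarrow> nat list \<Rightarrow> nat" where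
  "tree_deg N x = card (tree_nbrs N x)"

text \<open>Configuration space {0,1}^V with the product sigma-algebra (True = state 1).\<close>

definition conf_space :: "nat \<Rightarrow> (nat list \<Rightarrow> bool) measure" where
  "conf_space N = PiM (tree_vert N) (\<lambda>_. count_space UNIV)"

definition bernoulli_product :: "nat \<Rightarrow> real \<Rightarrow> (nat list \<Rightarrow> bool) measure" where
  "bernoulli_product N p = PiM (tree_vert N) (\<lambda>_. measure_pmf (bernoulli_pmf p))"

definition flip :: "nat list \<Rightarrow> (nat list \<Rightarrow> bool) \<Rightarrow> (nat list \<Rightarrow> bool)" where
  "flip x \<eta> = \<eta>(x := \<not> \<eta> x)"

definition bv_rate :: "nat \<Rightarrow> real \<Rightarrow> real \<Rightarrow> (nat list \<Rightarrow> bool) \<Rightarrow> nat list \<Rightarrow> real" where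
  "bv_rate N lam th \<eta> x =
     (if \<eta> x then th / real (tree_deg N x) * real (card {y \<in> tree_nbrs N x. \<not> \<eta> y})
      else lam / real (tree_deg N x) * real (card {y \<in> tree_nbrs N x. \<eta> y}))"

definition depends_only_on :: "nat list set \<Rightarrow> ((nat list \<Rightarrow> bool) \<Rightarrow> real) \<Rightarrow> bool" where
  "depends_only_on F f \<longleftrightarrow> (\<forall>\<eta> \<zeta>. (\<forall>x\<in>F. \<eta> x = \<zeta> x) \<longrightarrow> f \<eta> = f \<zeta>)"

text \<open>Generator applied to a cylinder function f depending only on the finite set F
(the terms for x outside F vanish).\<close>

definition bv_gen :: "nat \<Rightarrow> real \<Rightarrow> real \<Rightarrow> nat list set \<Rightarrow> ((nat list \<Rightarrow> bool) \<Rightarrow> real)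
    \<Rightarrow> (nat list \<Rightarrow> bool) \<Rightarrow> real" where
  "bv_gen N lam th F f \<eta> = (\<Sum>x\<in>F. bv_rate N lam th \<eta> x * (f (flip x \<eta>) - f \<eta>))"

text \<open>mu t is the distribution at time t of the bias voter model on T^N with
parameters lam, th and initial distribution mu_p: a family of probability measures
on the configuration space solving the Kolmogorov forward equation
d/dt (integral f d mu_t) = integral (Omega f) d mu_t for all cylinder functions f.\<close>

definition bias_voter_law :: "nat \<Rightarrow> real \<Rightarrow> real \<Rightarrow> real \<Rightarrow> (real \<Rightarrow> (nat list \<Rightarrow> bool) measure) \<Rightarrow> bool" where
  "bias_voter_law N lam th p \<mu> \<longleftrightarrow>
     (\<forall>t\<ge>0. prob_space (\<mu> t) \<and> sets (\<mu> t) = sets (conf_space N)) \<and>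
     \<mu> 0 = bernoulli_product N p \<and>
     (\<forall>F f. finite F \<longrightarrow> F \<subseteq> tree_vert N \<longrightarrow> depends_only_on F f \<longrightarrow>
        (\<forall>t\<ge>0. ((\<lambda>s. \<integral>\<eta>. f \<eta> \<partial>\<mu> s) has_real_derivative (\<integral>\<eta>. bv_gen N lam th F f \<eta> \<partial>\<mu> t))
                   (at t within {0..})))"

definition conf_top :: "nat \<Rightarrow> (nat list \<Rightarrow> bool) topology" where
  "conf_top N = product_topology (\<lambda>_. discrete_topology UNIV) (tree_vert N)"

definition all_ones :: "nat \<Rightarrow> nat list \<Rightarrow> bool" where
  "all_ones N = (\<lambda>x\<in>tree_vert N. True)"

definition weak_conv_to :: "nat \<Rightarrow> (real \<Rightarrow> (nat list \<Rightarrow> bool) measure) \<Rightarrow> (nat list \<Rightarrow> bool) \<Rightarrow> bool" where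
  "weak_conv_to N \<mu> \<xi> \<longleftrightarrow>
     (\<forall>f. continuous_map (conf_top N) euclideanreal f \<longrightarrow>
        ((\<lambda>t. \<integral>\<eta>. f \<eta> \<partial>\<mu> t) \<longlongrightarrow> f \<xi>) at_top)"

end

theory Submission
  imports Defs "HOL-Real_Asymp.Real_Asymp"
begin

text \<open>
  The probability that the configuration vanishes on a finite set $A$ of vertices evolves by the
  generator of a branching-coalescing random walk started from $A$: each particle jumps at rate
  $\theta$ and gives birth at rate $\lambda - \theta$, in both cases onto a uniform neighbour.
  In a tree a finite set $A$ spans at most $|A|$ edges, so at most $2|A|$ of its $(N+1)|A|$
  oriented edges point back into $A$. Hence, as soon as $(\lambda - \theta)(N - 1) > 2 \theta$,
  that is $\lambda / \theta > (N+1)/(N-1)$, the function $\rho^{|A|}$ with $\rho < 1$ close to 1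
  decays exponentially under the dual generator. A maximum principle, made rigorous with the
  Lyapunov function $\sum_{x \in A} (1 + |x|)$, whose sublevel sets are finite, gives
  $\mu_t(\eta = 0 \mbox{ on } A) \le e^{-\delta t} \rho^{|A|}$ with $\delta > 0$.
\<close>

section \<open>Regular trees\<close>

lemma tree_vert_butlast: "x \<in> tree_vert N \<Longrightarrow> butlast x \<in> tree_vert N"
  unfolding tree_vert_def by (auto simp: nth_butlast dest: in_set_butlastD)

lemma tree_vert_snoc:
  "x @ [a] \<in> tree_vert N \<longleftrightarrow> x \<in> tree_vert N \<and> a \<le> N \<and> (x = [] \<or> a \<noteq> last x)"
proof -
  have "(\<forall>i. Suc i < length (x @ [a]) \<longrightarrow> (x @ [a]) ! i \<noteq> (x @ [a]) ! Suc i) \<longleftrightarrow>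
    (\<forall>i. Suc i < length x \<longrightarrow> x ! i \<noteq> x ! Suc i) \<and> (x = [] \<or> a \<noteq> last x)" (is "?L \<longleftrightarrow> ?R")
  proof
    assume L: ?L
    show ?R
    proof (intro conjI allI impI)
      fix i assume "Suc i < length x"
      then show "x ! i \<noteq> x ! Suc i" using L[rule_format, of i] by (simp add: nth_append)
    next
      show "x = [] \<or> a \<noteq> last x"
        using L[rule_format, of "length x - 1"] by (cases "x = []") (auto simp: nth_append last_conv_nth)
    qed
  next
    assume R: ?R
    show ?L
    proof (intro allI impI)
      fix i assume i: "Suc i < length (x @ [a])"
      show "(x @ [a]) ! i \<noteq> (x @ [a]) ! Suc i"
      proof (cases "Suc i < length x")
        case True then show ?thesis using R by (simp add: nth_append)
      next
        case False
        with i have "length x = Suc i" by simp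
        then have "x \<noteq> []" by auto
        then have "last x = x ! i" using \<open>length x = Suc i\<close> by (simp add: last_conv_nth)
        with \<open>x \<noteq> []\<close> show ?thesis using R \<open>length x = Suc i\<close> by (auto simp: nth_append)
      qed
    qed
  qed
  then show ?thesis unfolding tree_vert_def by auto
qed

lemma tree_nbrs_eq:
  assumes "x \<in> tree_vert N"
  shows "tree_nbrs N x = (if x = [] then {} else {butlast x}) \<union>
     (\<lambda>a. x @ [a]) ` {a \<in> {..N}. x = [] \<or> a \<noteq> last x}" (is "_ = ?R")
proof (intro set_eqI iffI)
  fix y assume y: "y \<in> tree_nbrs N x"
  show "y \<in> ?R"
  proof (cases "x \<noteq> [] \<and> y = butlast x")
    case False
    with y have "y \<in> tree_vert N" "y \<noteq> []" "butlast y = x" by (auto simp: tree_nbrs_def)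
    then obtain a where "y = x @ [a]" using append_butlast_last_id by metis
    with \<open>y \<in> tree_vert N\<close> show ?thesis by (auto simp: tree_vert_snoc)
  qed auto
next
  fix y assume "y \<in> ?R"
  then show "y \<in> tree_nbrs N x"
    using assms tree_vert_snoc[of x]
    by (auto simp: tree_nbrs_def tree_vert_butlast simp del: append_Nil split: if_splits)
qed

lemma finite_tree_nbrs: "x \<in> tree_vert N \<Longrightarrow> finite (tree_nbrs N x)"
  by (simp add: tree_nbrs_eq)

lemma tree_nbrs_subset: "tree_nbrs N x \<subseteq> tree_vert N"
  by (auto simp: tree_nbrs_def)

lemma tree_nbrs_irrefl: "x \<notin> tree_nbrs N x"
proof
  assume "x \<in> tree_nbrs N x"
  then have "x \<noteq> []" "butlast x = x" by (auto simp: tree_nbrs_def)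
  then show False by (cases x rule: rev_cases) auto
qed

lemma length_tree_nbr: "y \<in> tree_nbrs N x \<Longrightarrow> length y \<le> Suc (length x)"
  by (auto simp: tree_nbrs_def)

lemma tree_deg_eq:
  assumes "x \<in> tree_vert N"
  shows "tree_deg N x = Suc N"
proof (cases "x = []")
  case True
  then show ?thesis unfolding tree_deg_def tree_nbrs_eq[OF assms] by (simp add: card_image inj_on_def)
next
  case False
  have "last x \<le> N" using assms last_in_set[OF False] by (force simp: tree_vert_def)
  moreover have "{a \<in> {..N}. x = [] \<or> a \<noteq> last x} = {..N} - {last x}" using False by auto
  ultimately have "card ((\<lambda>a. x @ [a]) ` {a \<in> {..N}. x = [] \<or> a \<noteq> last x}) = N"
    by (simp add: card_image inj_on_def)
  moreover have "butlast x \<notin> (\<lambda>a. x @ [a]) ` {a \<in> {..N}. x = [] \<or> a \<noteq> last x}"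
  proof
    assume "butlast x \<in> (\<lambda>a. x @ [a]) ` {a \<in> {..N}. x = [] \<or> a \<noteq> last x}"
    then obtain a where "butlast x = x @ [a]" by blast
    then have "length (butlast x) = Suc (length x)" by simp
    then show False by simp
  qed
  ultimately show ?thesis using False unfolding tree_deg_def tree_nbrs_eq[OF assms] by simp
qed

lemma sum_card_tree_nbrs_Int_le:
  assumes "finite A"
  shows "(\<Sum>x\<in>A. card (tree_nbrs N x \<inter> A)) \<le> 2 * card A"
proof -
  have "card (tree_nbrs N x \<inter> A) \<le> 1 + (\<Sum>y\<in>A. if y \<noteq> [] \<and> butlast y = x then 1 else 0)" for x
  proof -
    have "card (tree_nbrs N x \<inter> A) \<le> card ({butlast x} \<union> {y \<in> A. y \<noteq> [] \<and> butlast y = x})"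
      by (rule card_mono) (use assms in \<open>auto simp: tree_nbrs_def\<close>)
    also have "\<dots> \<le> card {butlast x} + card {y \<in> A. y \<noteq> [] \<and> butlast y = x}"
      by (rule card_Un_le)
    also have "card {y \<in> A. y \<noteq> [] \<and> butlast y = x} = (\<Sum>y\<in>A. if y \<noteq> [] \<and> butlast y = x then 1 else 0)"
      using assms by (simp flip: sum.inter_filter)
    finally show ?thesis by simp
  qed
  then have "(\<Sum>x\<in>A. card (tree_nbrs N x \<inter> A))
      \<le> (\<Sum>x\<in>A. 1 + (\<Sum>y\<in>A. if y \<noteq> [] \<and> butlast y = x then 1 else 0))"
    by (intro sum_mono)
  also have "\<dots> = card A + (\<Sum>y\<in>A. \<Sum>x\<in>A. if y \<noteq> [] \<and> butlast y = x then 1 else 0)"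
    by (simp only: sum.distrib) (subst sum.swap, simp)
  also have "(\<Sum>y\<in>A. \<Sum>x\<in>A. if y \<noteq> [] \<and> butlast y = x then 1 else 0) \<le> (\<Sum>y\<in>A. 1::nat)"
  proof (rule sum_mono)
    fix y
    show "(\<Sum>x\<in>A. if y \<noteq> [] \<and> butlast y = x then 1 else 0) \<le> (1::nat)"
      using assms by (cases "y = []") simp_all
  qed
  finally show ?thesis by simp
qed

section \<open>A comparison principle\<close>

lemma positivity_comparison:
  fixes w D :: "real \<Rightarrow> 'a \<Rightarrow> real"
  assumes deriv: "\<And>t a. 0 \<le> t \<Longrightarrow> a \<in> S \<Longrightarrow> ((\<lambda>s. w s a) has_real_derivative D t a) (at t within {0..})"
    and init: "\<And>a. a \<in> S \<Longrightarrow> w 0 a > 0"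
    and fin: "finite K" "K \<subseteq> S"
    and outside: "\<And>t a. 0 \<le> t \<Longrightarrow> a \<in> S - K \<Longrightarrow> w t a > 0"
    and touch: "\<And>t a. 0 \<le> t \<Longrightarrow> a \<in> S \<Longrightarrow> w t a = 0 \<Longrightarrow> (\<And>b. b \<in> S \<Longrightarrow> w t b \<ge> 0) \<Longrightarrow> D t a > 0"
    and "0 \<le> T" "a \<in> S"
  shows "w T a > 0"
proof (rule ccontr)
  assume "\<not> w T a > 0"
  with outside \<open>0 \<le> T\<close> \<open>a \<in> S\<close> have aK: "a \<in> K" "w T a \<le> 0" by force+
  have cont: "continuous_on {0..} (\<lambda>s. w s b)" if "b \<in> S" for b
    using deriv that by (intro DERIV_continuous_on) auto
  define B where "B = (\<Union>b\<in>K. {t \<in> {0..T}. w t b \<le> 0})"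
  have "closed {t \<in> {0..T}. w t b \<le> 0}" if "b \<in> K" for b
    using that fin by (intro continuous_on_closed_Collect_le continuous_on_subset[OF cont]) auto
  then have "closed B" unfolding B_def using fin by (intro closed_UN) auto
  moreover have "bounded B" by (rule bounded_subset[of "{0..T}"]) (auto simp: B_def)
  ultimately have "compact B" by (simp add: compact_eq_bounded_closed)
  moreover have "T \<in> B" using aK \<open>0 \<le> T\<close> by (auto simp: B_def)
  ultimately obtain t where t: "t \<in> B" "\<And>s. s \<in> B \<Longrightarrow> t \<le> s"
    using compact_attains_inf[of B] by blast
  from t(1) obtain b where b: "b \<in> K" "w t b \<le> 0" "0 \<le> t" "t \<le> T" by (auto simp: B_def)
  with init fin have "t > 0" by (cases "t = 0") force+
  have before: "w s c > 0" if "0 \<le> s" "s < t" "c \<in> S" for s c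
  proof (rule ccontr)
    assume "\<not> w s c > 0"
    with outside that have "c \<in> K" by force
    then have "s \<in> B" using that b \<open>\<not> w s c > 0\<close> by (auto simp: B_def not_less)
    with t(2) that show False by force
  qed
  have lim: "((\<lambda>s. w s c) \<longlongrightarrow> w t c) (at_left t)" if "c \<in> S" for c
  proof -
    have "isCont (\<lambda>s. w s c) t"
      using continuous_on_interior[OF cont[OF that], of t] \<open>t > 0\<close> by simp
    then show ?thesis by (simp add: isCont_def filterlim_at_split)
  qed
  have ev: "\<forall>\<^sub>F s in at_left t. 0 \<le> s \<and> s < t"
    unfolding eventually_at_left[OF \<open>t > 0\<close>] using \<open>t > 0\<close> by (intro exI[of _ 0]) auto
  have nonneg: "w t c \<ge> 0" if "c \<in> S" for c
    by (rule tendsto_lowerbound[OF lim[OF that]])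
       (use ev before that in \<open>auto elim!: eventually_mono intro: less_imp_le\<close>)
  have bS: "b \<in> S" using b fin by auto
  have zero: "w t b = 0" using nonneg[OF bS] b by simp
  have "D t b > 0" by (rule touch) (use b bS zero nonneg in auto)
  moreover have "((\<lambda>s. w s b) has_real_derivative D t b) (at t)"
    using deriv[OF b(3) bS] \<open>t > 0\<close> at_within_interior[of t "{0..}"] by simp
  ultimately obtain d where d: "d > 0" "\<And>h. 0 < h \<Longrightarrow> h < d \<Longrightarrow> w (t - h) b < w t b"
    using DERIV_pos_inc_left by metis
  define h where "h = min (d / 2) t"
  have "w (t - h) b < w t b" using d \<open>t > 0\<close> by (intro d(2)) (auto simp: h_def)
  moreover have "w (t - h) b > 0" using d \<open>t > 0\<close> bS by (intro before) (auto simp: h_def)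
  ultimately show False using zero by simp
qed

section \<open>The dual branching-coalescing generator\<close>

definition zero_on :: "nat list set \<Rightarrow> (nat list \<Rightarrow> bool) \<Rightarrow> real" where
  "zero_on A \<eta> = (if \<forall>x\<in>A. \<not> \<eta> x then 1 else 0)"

definition dual_gen :: "nat \<Rightarrow> real \<Rightarrow> real \<Rightarrow> (nat list set \<Rightarrow> real) \<Rightarrow> nat list set \<Rightarrow> real" where
  "dual_gen N lam th g A = (\<Sum>x\<in>A. \<Sum>y\<in>tree_nbrs N x.
     ((lam - th) * (g (insert y A) - g A) + th * (g (insert y (A - {x})) - g A)) / real (Suc N))"

lemma bv_gen_zero_on:
  assumes "finite A" "A \<subseteq> tree_vert N"
  shows "bv_gen N lam th A (zero_on A) \<eta> = dual_gen N lam th (\<lambda>B. zero_on B \<eta>) A"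
  unfolding bv_gen_def dual_gen_def
proof (rule sum.cong[OF refl])
  fix x assume x: "x \<in> A"
  with assms have xV: "x \<in> tree_vert N" by auto
  note fin = finite_tree_nbrs[OF xV]
  have card: "real (card {y \<in> tree_nbrs N x. P y}) = (\<Sum>y\<in>tree_nbrs N x. if P y then 1 else 0)" for P
    using fin by (simp flip: sum.inter_filter)
  have rate: "bv_rate N lam th \<eta> x = (\<Sum>y\<in>tree_nbrs N x.
     (if \<eta> x then th * (if \<not> \<eta> y then 1 else 0) else lam * (if \<eta> y then 1 else 0)) / real (Suc N))"
    unfolding bv_rate_def tree_deg_eq[OF xV] card
    by (simp add: sum_divide_distrib sum_distrib_left)
  show "bv_rate N lam th \<eta> x * (zero_on A (flip x \<eta>) - zero_on A \<eta>) = (\<Sum>y\<in>tree_nbrs N x.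
     ((lam - th) * (zero_on (insert y A) \<eta> - zero_on A \<eta>) +
       th * (zero_on (insert y (A - {x})) \<eta> - zero_on A \<eta>)) / real (Suc N))"
    unfolding rate sum_distrib_right
  proof (rule sum.cong[OF refl])
    fix y assume "y \<in> tree_nbrs N x"
    then have "y \<noteq> x" using tree_nbrs_irrefl by auto
    have 1: "(\<forall>z\<in>A. \<not> \<eta> z) \<longleftrightarrow> \<not> \<eta> x \<and> (\<forall>z\<in>A - {x}. \<not> \<eta> z)" using x by auto
    have 2: "(\<forall>z\<in>A. \<not> flip x \<eta> z) \<longleftrightarrow> \<eta> x \<and> (\<forall>z\<in>A - {x}. \<not> \<eta> z)"
      using x by (auto simp: flip_def)
    have 3: "(\<forall>z\<in>insert y B. \<not> \<eta> z) \<longleftrightarrow> \<not> \<eta> y \<and> (\<forall>z\<in>B. \<not> \<eta> z)" for B by auto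
    show "(if \<eta> x then th * (if \<not> \<eta> y then 1 else 0) else lam * (if \<eta> y then 1 else 0)) / real (Suc N)
       * (zero_on A (flip x \<eta>) - zero_on A \<eta>) =
      ((lam - th) * (zero_on (insert y A) \<eta> - zero_on A \<eta>) +
       th * (zero_on (insert y (A - {x})) \<eta> - zero_on A \<eta>)) / real (Suc N)"
      unfolding zero_on_def 2 3 unfolding 1
      by (cases "\<eta> x"; cases "\<eta> y"; cases "\<forall>z\<in>A - {x}. \<not> \<eta> z") (simp_all add: field_simps)
  qed
qed

lemma dual_gen_add: "dual_gen N lam th (\<lambda>B. f B + g B) A = dual_gen N lam th f A + dual_gen N lam th g A"
  unfolding dual_gen_def sum.distrib[symmetric] add_divide_distrib[symmetric]
  by (intro sum.cong refl arg_cong2[where f = "(/)"]) (simp add: algebra_simps)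

lemma dual_gen_diff: "dual_gen N lam th (\<lambda>B. f B - g B) A = dual_gen N lam th f A - dual_gen N lam th g A"
  unfolding dual_gen_def sum_subtractf[symmetric] diff_divide_distrib[symmetric]
  by (intro sum.cong refl arg_cong2[where f = "(/)"]) (simp add: algebra_simps)

lemma dual_gen_cmult: "dual_gen N lam th (\<lambda>B. c * f B) A = c * dual_gen N lam th f A"
  unfolding dual_gen_def sum_distrib_left times_divide_eq_right
  by (intro sum.cong refl arg_cong2[where f = "(/)"]) (simp add: algebra_simps)

lemma dual_gen_nonneg:
  assumes "0 \<le> th" "th \<le> lam" "g A = 0" "finite A" "A \<subseteq> tree_vert N"
    and "\<And>B. finite B \<Longrightarrow> B \<noteq> {} \<Longrightarrow> B \<subseteq> tree_vert N \<Longrightarrow> g B \<ge> 0"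
  shows "dual_gen N lam th g A \<ge> 0"
  unfolding dual_gen_def
proof (intro sum_nonneg divide_nonneg_nonneg)
  fix x y assume "x \<in> A" "y \<in> tree_nbrs N x"
  then have "y \<in> tree_vert N" using tree_nbrs_subset by auto
  then have "g (insert y A) \<ge> 0" "g (insert y (A - {x})) \<ge> 0"
    using assms by (auto intro!: assms(6))
  then show "0 \<le> (lam - th) * (g (insert y A) - g A) + th * (g (insert y (A - {x})) - g A)"
    using assms by simp
qed auto

definition depth_mass :: "nat list set \<Rightarrow> real" where
  "depth_mass A = (\<Sum>x\<in>A. 1 + real (length x))"

lemma depth_mass_ge_1:
  assumes "finite A" "A \<noteq> {}"
  shows "depth_mass A \<ge> 1"
proof -
  obtain x where "x \<in> A" using assms by auto
  then have "1 + real (length x) \<le> depth_mass A"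
    unfolding depth_mass_def using assms by (intro member_le_sum) auto
  then show ?thesis by simp
qed

lemma finite_depth_mass_le: "finite {A. finite A \<and> A \<subseteq> tree_vert N \<and> depth_mass A \<le> c}"
proof (rule finite_subset)
  show "{A. finite A \<and> A \<subseteq> tree_vert N \<and> depth_mass A \<le> c}
    \<subseteq> Pow {x. set x \<subseteq> {..N} \<and> length x \<le> nat \<lceil>c\<rceil>}"
  proof (intro subsetI PowI CollectI)
    fix A x assume A: "A \<in> {A. finite A \<and> A \<subseteq> tree_vert N \<and> depth_mass A \<le> c}" and x: "x \<in> A"
    then have "1 + real (length x) \<le> depth_mass A"
      unfolding depth_mass_def by (intro member_le_sum) auto
    with A have "real (length x) \<le> c" by simp
    moreover have "set x \<subseteq> {..N}" using A x by (auto simp: tree_vert_def)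
    ultimately show "set x \<subseteq> {..N} \<and> length x \<le> nat \<lceil>c\<rceil>" by linarith
  qed
  show "finite (Pow {x::nat list. set x \<subseteq> {..N} \<and> length x \<le> nat \<lceil>c\<rceil>})"
    by (simp add: finite_lists_length_le)
qed

lemma dual_gen_depth_mass_le:
  assumes "0 \<le> th" "th \<le> lam" "finite A" "A \<subseteq> tree_vert N"
  shows "dual_gen N lam th depth_mass A \<le> 2 * lam * depth_mass A"
proof -
  have ins: "depth_mass (insert y B) \<le> depth_mass B + (1 + real (length y))" if "finite B" for y B
    using that by (cases "y \<in> B") (auto simp: depth_mass_def insert_absorb)
  have "dual_gen N lam th depth_mass A \<le>
    (\<Sum>x\<in>A. \<Sum>y\<in>tree_nbrs N x. (2 * lam * (1 + real (length x))) / real (Suc N))"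
    unfolding dual_gen_def
  proof (intro sum_mono divide_right_mono)
    fix x y assume x: "x \<in> A" and y: "y \<in> tree_nbrs N x"
    have y': "1 + real (length y) \<le> 2 * (1 + real (length x))" using length_tree_nbr[OF y] by simp
    have "depth_mass (A - {x}) \<le> depth_mass A"
      unfolding depth_mass_def using assms by (intro sum_mono2) auto
    then have "depth_mass (insert y (A - {x})) - depth_mass A \<le> 2 * (1 + real (length x))"
      using ins[of "A - {x}" y] assms y' by auto
    moreover have "depth_mass (insert y A) - depth_mass A \<le> 2 * (1 + real (length x))"
      using ins[of A y] assms y' by auto
    ultimately have "(lam - th) * (depth_mass (insert y A) - depth_mass A) + th * (depth_mass (insert y (A - {x})) - depth_mass A)
       \<le> (lam - th) * (2 * (1 + real (length x))) + th * (2 * (1 + real (length x)))"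
      using assms by (intro add_mono mult_left_mono) auto
    also have "\<dots> = 2 * lam * (1 + real (length x))" by (simp add: algebra_simps)
    finally show "(lam - th) * (depth_mass (insert y A) - depth_mass A) + th * (depth_mass (insert y (A - {x})) - depth_mass A)
      \<le> 2 * lam * (1 + real (length x))" .
  qed auto
  also have "\<dots> = (\<Sum>x\<in>A. 2 * lam * (1 + real (length x)))"
  proof (rule sum.cong[OF refl])
    fix x assume "x \<in> A"
    then have "card (tree_nbrs N x) = Suc N" using tree_deg_eq assms by (auto simp: tree_deg_def)
    then show "(\<Sum>y\<in>tree_nbrs N x. (2 * lam * (1 + real (length x))) / real (Suc N)) = 2 * lam * (1 + real (length x))"
      by simp
  qed
  also have "\<dots> = 2 * lam * depth_mass A" by (simp add: depth_mass_def sum_distrib_left)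
  finally show ?thesis .
qed

lemma dual_gen_power_card_le:
  assumes "0 < th" "th < lam" "N \<ge> 2" "finite A" "A \<noteq> {}" "A \<subseteq> tree_vert N" "0 < \<rho>" "\<rho> < 1"
    and drift: "2 * th / \<rho> < (lam - th) * (real N - 1)"
  shows "dual_gen N lam th (\<lambda>B. \<rho> ^ card B) A \<le>
    - ((1 - \<rho>) / real (Suc N) * ((lam - th) * (real N - 1) - 2 * th / \<rho>)) * \<rho> ^ card A"
proof -
  define k where "k = real (card A)"
  define e where "e = (\<Sum>x\<in>A. card (tree_nbrs N x \<inter> A))"
  define c where "c = (1 - \<rho>) * \<rho> ^ card A / real (Suc N)"
  have c: "c > 0" using assms by (simp add: c_def)
  have k: "k \<ge> 1" using assms by (simp add: k_def Suc_le_eq card_gt_0_iff)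
  have "dual_gen N lam th (\<lambda>B. \<rho> ^ card B) A =
    (\<Sum>x\<in>A. \<Sum>y\<in>tree_nbrs N x. c * (if y \<in> A then th / \<rho> else - (lam - th)))"
    unfolding dual_gen_def
  proof (intro sum.cong refl)
    fix x y assume x: "x \<in> A" and y: "y \<in> tree_nbrs N x"
    have "y \<noteq> x" using tree_nbrs_irrefl y by auto
    obtain m where m: "card A = Suc m" using x assms by (metis card_Suc_Diff1)
    show "((lam - th) * (\<rho> ^ card (insert y A) - \<rho> ^ card A) +
        th * (\<rho> ^ card (insert y (A - {x})) - \<rho> ^ card A)) / real (Suc N) =
        c * (if y \<in> A then th / \<rho> else - (lam - th))"
    proof (cases "y \<in> A")
      case True
      then have "insert y A = A" "insert y (A - {x}) = A - {x}" using \<open>y \<noteq> x\<close> by auto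
      moreover have "card (A - {x}) = m" using m x assms by simp
      ultimately have "((lam - th) * (\<rho> ^ card (insert y A) - \<rho> ^ card A) +
        th * (\<rho> ^ card (insert y (A - {x})) - \<rho> ^ card A)) / real (Suc N) =
        (1 - \<rho>) * \<rho> ^ m * th / real (Suc N)"
        by (simp add: m algebra_simps)
      also have "\<rho> ^ m = \<rho> ^ card A / \<rho>" using m assms by simp
      finally show ?thesis using True by (simp add: c_def)
    next
      case False
      then have "card (insert y A) = Suc (card A)" "card (insert y (A - {x})) = card A"
        using x assms m by auto
      then show ?thesis using False by (simp add: c_def algebra_simps)
    qed
  qed
  also have "\<dots> = c * (\<Sum>x\<in>A. \<Sum>y\<in>tree_nbrs N x. (if y \<in> A then th / \<rho> else - (lam - th)))"
    by (simp add: sum_distrib_left)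
  also have "(\<Sum>x\<in>A. \<Sum>y\<in>tree_nbrs N x. (if y \<in> A then th / \<rho> else - (lam - th))) =
    (\<Sum>x\<in>A. (th / \<rho> + (lam - th)) * real (card (tree_nbrs N x \<inter> A)) - (lam - th) * real (Suc N))"
  proof (rule sum.cong[OF refl])
    fix x assume "x \<in> A"
    then have xV: "x \<in> tree_vert N" using assms by auto
    have "(\<Sum>y\<in>tree_nbrs N x. (if y \<in> A then th / \<rho> else - (lam - th))) =
      (\<Sum>y\<in>tree_nbrs N x. (th / \<rho> + (lam - th)) * (if y \<in> A then 1 else 0) - (lam - th))"
      by (intro sum.cong) auto
    also have "\<dots> = (th / \<rho> + (lam - th)) * (\<Sum>y\<in>tree_nbrs N x. if y \<in> A then 1 else 0) - (lam - th) * real (card (tree_nbrs N x))"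
      by (subst sum_subtractf) (simp add: sum_distrib_left mult.commute)
    also have "(\<Sum>y\<in>tree_nbrs N x. if y \<in> A then 1 else 0) = real (card (tree_nbrs N x \<inter> A))"
      using finite_tree_nbrs[OF xV] by (simp add: sum.inter_restrict[symmetric])
    finally show "(\<Sum>y\<in>tree_nbrs N x. (if y \<in> A then th / \<rho> else - (lam - th))) =
      (th / \<rho> + (lam - th)) * real (card (tree_nbrs N x \<inter> A)) - (lam - th) * real (Suc N)"
      using tree_deg_eq[OF xV] by (simp add: tree_deg_def)
  qed
  also have "\<dots> = (th / \<rho> + (lam - th)) * real e - (lam - th) * real (Suc N) * k"
    by (simp add: sum_subtractf sum_distrib_left[symmetric] e_def k_def)
  also have "c * \<dots> \<le> c * (- ((lam - th) * (real N - 1) - 2 * th / \<rho>))"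
  proof (rule mult_left_mono)
    have "real e \<le> real (2 * card A)"
      unfolding e_def of_nat_le_iff by (rule sum_card_tree_nbrs_Int_le[OF assms(4)])
    then have "real e \<le> 2 * k" by (simp add: k_def)
    then have "(th / \<rho> + (lam - th)) * real e \<le> (th / \<rho> + (lam - th)) * (2 * k)"
      using assms by (intro mult_left_mono) auto
    then have "(th / \<rho> + (lam - th)) * real e - (lam - th) * real (Suc N) * k
      \<le> - (((lam - th) * (real N - 1) - 2 * th / \<rho>) * k)"
      by (simp add: algebra_simps)
    moreover have "((lam - th) * (real N - 1) - 2 * th / \<rho>) * 1 \<le> ((lam - th) * (real N - 1) - 2 * th / \<rho>) * k"
      using k drift by (intro mult_left_mono) auto
    ultimately show "(th / \<rho> + (lam - th)) * real e - (lam - th) * real (Suc N) * k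
      \<le> - ((lam - th) * (real N - 1) - 2 * th / \<rho>)" by (simp only: mult_1_right)
  qed (use c in simp)
  also have "\<dots> = - ((1 - \<rho>) / real (Suc N) * ((lam - th) * (real N - 1) - 2 * th / \<rho>)) * \<rho> ^ card A"
    unfolding c_def by (simp only: minus_mult_right[symmetric] minus_mult_left[symmetric]
      times_divide_eq_left times_divide_eq_right mult.assoc mult.commute mult.left_commute)
  finally show ?thesis .
qed

section \<open>Void probabilities of the bias voter model\<close>

lemma zero_on_prod: "finite A \<Longrightarrow> zero_on A \<eta> = (\<Prod>x\<in>A. if \<eta> x then 0 else 1)"
  by (induction A rule: finite_induct) (auto simp: zero_on_def)

lemma zero_on_bounds: "0 \<le> zero_on A \<eta>" "zero_on A \<eta> \<le> 1"
  by (auto simp: zero_on_def)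

lemma measurable_coord:
  "x \<in> tree_vert N \<Longrightarrow> (\<lambda>\<eta>. \<eta> x) \<in> measurable (conf_space N) (count_space UNIV)"
  unfolding conf_space_def by (rule measurable_component_singleton)

lemma zero_on_measurable:
  assumes "finite A" "A \<subseteq> tree_vert N"
  shows "zero_on A \<in> borel_measurable (conf_space N)"
proof -
  have "(\<lambda>\<eta>. (if \<eta> x then 0 else 1) :: real) \<in> borel_measurable (conf_space N)" if "x \<in> A" for x
    using measurable_compose[OF measurable_coord, of x N "\<lambda>b. (if b then 0 else 1) :: real" borel] that assms
    by auto
  then have "(\<lambda>\<eta>. \<Prod>x\<in>A. (if \<eta> x then 0 else 1) :: real) \<in> borel_measurable (conf_space N)"
    by (rule borel_measurable_prod)
  then show ?thesis by (simp add: zero_on_prod[OF assms(1), abs_def])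
qed

lemma zero_on_integrable:
  assumes "prob_space M" "sets M = sets (conf_space N)" "finite A" "A \<subseteq> tree_vert N"
  shows "integrable M (zero_on A)"
proof -
  interpret prob_space M by fact
  have "zero_on A \<in> borel_measurable M"
    using zero_on_measurable[OF assms(3,4)] measurable_cong_sets[OF assms(2) refl] by blast
  then show ?thesis
    by (intro integrable_const_bound[where B = 1]) (auto simp: zero_on_def)
qed

lemma integral_zero_on_bernoulli:
  assumes "finite A" "A \<subseteq> tree_vert N" "0 \<le> p" "p \<le> 1"
  shows "(\<integral>\<eta>. zero_on A \<eta> \<partial>bernoulli_product N p) = (1 - p) ^ card A"
proof -
  interpret product_prob_space "\<lambda>_. measure_pmf (bernoulli_pmf p)" "tree_vert N"
    by unfold_locales
  let ?P = "PiM (tree_vert N) (\<lambda>_. measure_pmf (bernoulli_pmf p))"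
  let ?E = "prod_emb (tree_vert N) (\<lambda>_. measure_pmf (bernoulli_pmf p)) A (Pi\<^sub>E A (\<lambda>_. {False}))"
  have "(\<integral>\<eta>. zero_on A \<eta> \<partial>?P) = (\<integral>\<eta>. indicator ?E \<eta> \<partial>?P)"
  proof (rule Bochner_Integration.integral_cong[OF refl])
    fix \<eta> assume "\<eta> \<in> space ?P"
    then have "\<eta> \<in> ?E \<longleftrightarrow> (\<forall>x\<in>A. \<not> \<eta> x)"
      by (auto simp: prod_emb_def space_PiM PiE_iff restrict_def fun_eq_iff)
    then show "zero_on A \<eta> = indicator ?E \<eta>" by (simp add: zero_on_def indicator_def)
  qed
  also have "\<dots> = measure ?P (?E \<inter> space ?P)" by simp
  also have "?E \<inter> space ?P = ?E" by (auto simp: prod_emb_def space_PiM)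
  also have "measure ?P ?E = (\<Prod>x\<in>A. measure (measure_pmf (bernoulli_pmf p)) {False})"
    using assms by (intro measure_PiM_emb) auto
  also have "\<dots> = (1 - p) ^ card A" using assms by (simp add: measure_pmf_single)
  finally show ?thesis by (simp add: bernoulli_product_def)
qed

lemma void_prob_deriv:
  assumes law: "bias_voter_law N lam th p \<mu>" and "finite A" "A \<subseteq> tree_vert N" "0 \<le> t"
  shows "((\<lambda>s. \<integral>\<eta>. zero_on A \<eta> \<partial>\<mu> s) has_real_derivative
    dual_gen N lam th (\<lambda>B. \<integral>\<eta>. zero_on B \<eta> \<partial>\<mu> t) A) (at t within {0..})"
proof -
  have M: "prob_space (\<mu> t)" "sets (\<mu> t) = sets (conf_space N)"
    using law assms(4) by (auto simp: bias_voter_law_def)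
  note int = zero_on_integrable[OF M]
  have "(\<integral>\<eta>. bv_gen N lam th A (zero_on A) \<eta> \<partial>\<mu> t) =
      (\<integral>\<eta>. dual_gen N lam th (\<lambda>B. zero_on B \<eta>) A \<partial>\<mu> t)"
    using bv_gen_zero_on[OF assms(2,3)] by simp
  also have "\<dots> = dual_gen N lam th (\<lambda>B. \<integral>\<eta>. zero_on B \<eta> \<partial>\<mu> t) A"
  proof -
    have *: "integrable (\<mu> t) (zero_on (insert y A))" "integrable (\<mu> t) (zero_on (insert y (A - {x})))"
      if "y \<in> tree_nbrs N x" for x y
      using that tree_nbrs_subset assms by (auto intro!: int)
    note [simp] = * int[OF assms(2,3)]
    show ?thesis unfolding dual_gen_def by simp
  qed
  finally have "(\<integral>\<eta>. bv_gen N lam th A (zero_on A) \<eta> \<partial>\<mu> t) =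
      dual_gen N lam th (\<lambda>B. \<integral>\<eta>. zero_on B \<eta> \<partial>\<mu> t) A" .
  moreover have "depends_only_on A (zero_on A)"
    by (auto simp: depends_only_on_def zero_on_def)
  then have "((\<lambda>s. \<integral>\<eta>. zero_on A \<eta> \<partial>\<mu> s) has_real_derivative
      (\<integral>\<eta>. bv_gen N lam th A (zero_on A) \<eta> \<partial>\<mu> t)) (at t within {0..})"
    using law assms(2-4) unfolding bias_voter_law_def by blast
  ultimately show ?thesis by simp
qed

lemma void_prob_decay:
  assumes law: "bias_voter_law N lam th p \<mu>"
    and par: "0 < th" "th < lam" "N \<ge> 2" "0 < p" "p < 1"
    and \<rho>: "1 - p \<le> \<rho>" "\<rho> < 1" "2 * th / \<rho> < (lam - th) * (real N - 1)"
    and A: "finite A" "A \<noteq> {}" "A \<subseteq> tree_vert N" and "0 \<le> t"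
  shows "(\<integral>\<eta>. zero_on A \<eta> \<partial>\<mu> t) \<le>
    exp (- ((1 - \<rho>) / real (Suc N) * ((lam - th) * (real N - 1) - 2 * th / \<rho>)) * t) * \<rho> ^ card A"
proof -
  define \<delta> where "\<delta> = (1 - \<rho>) / real (Suc N) * ((lam - th) * (real N - 1) - 2 * th / \<rho>)"
  define C where "C = 2 * lam + 1"
  define u where "u = (\<lambda>(t :: real) B. \<integral>\<eta>. zero_on B \<eta> \<partial>\<mu> t)"
  define S where "S = {B. finite B \<and> B \<noteq> {} \<and> B \<subseteq> tree_vert N}"
  have \<rho>0: "0 < \<rho>" using \<rho> par by simp
  have u_le_1: "u s B \<le> 1" if "0 \<le> s" "B \<in> S" for s B
  proof -
    have M: "prob_space (\<mu> s)" "sets (\<mu> s) = sets (conf_space N)"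
      using law that by (auto simp: bias_voter_law_def)
    interpret prob_space "\<mu> s" by (rule M)
    show ?thesis unfolding u_def
      using that by (intro integral_le_const zero_on_integrable[OF M]) (auto simp: S_def zero_on_bounds)
  qed
  have approx: "u t A < exp (- \<delta> * t) * \<rho> ^ card A + \<epsilon> * (exp (C * t) * depth_mass A)" if \<epsilon>: "\<epsilon> > 0" for \<epsilon>
  proof -
    define w where "w = (\<lambda>(s :: real) B. exp (- \<delta> * s) * \<rho> ^ card B + \<epsilon> * exp (C * s) * depth_mass B - u s B)"
    define D where "D = (\<lambda>(s :: real) B. - \<delta> * (exp (- \<delta> * s) * \<rho> ^ card B) + C * (\<epsilon> * exp (C * s) * depth_mass B)
       - dual_gen N lam th (u s) B)"
    have "w t A > 0"
    proof (rule positivity_comparison[where w = w and S = S and D = D and K = "{B \<in> S. depth_mass B \<le> 1 / \<epsilon>}"])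
      fix s :: real and B assume "0 \<le> s" "B \<in> S"
      then have "((\<lambda>s. u s B) has_real_derivative dual_gen N lam th (u s) B) (at s within {0..})"
        unfolding u_def by (intro void_prob_deriv[OF law]) (auto simp: S_def)
      then show "((\<lambda>s. w s B) has_real_derivative D s B) (at s within {0..})"
        unfolding w_def D_def by (auto intro!: derivative_eq_intros)
    next
      fix B assume B: "B \<in> S"
      have "\<mu> 0 = bernoulli_product N p" using law by (auto simp: bias_voter_law_def)
      then have "u 0 B = (1 - p) ^ card B"
        unfolding u_def using B par by (auto simp: S_def integral_zero_on_bernoulli)
      also have "\<dots> \<le> \<rho> ^ card B" using \<rho> par by (intro power_mono) auto
      moreover have "depth_mass B > 0" using depth_mass_ge_1[of B] B by (auto simp: S_def)
      then have "\<epsilon> * depth_mass B > 0" using \<epsilon> by simp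
      ultimately show "w 0 B > 0" by (simp add: w_def)
    next
      show "finite {B \<in> S. depth_mass B \<le> 1 / \<epsilon>}"
        by (rule finite_subset[OF _ finite_depth_mass_le[of N "1 / \<epsilon>"]]) (auto simp: S_def)
    next
      fix s :: real and B assume s: "0 \<le> s" and B: "B \<in> S - {B \<in> S. depth_mass B \<le> 1 / \<epsilon>}"
      then have "1 < \<epsilon> * depth_mass B" using \<epsilon> by (auto simp: field_simps)
      also have "\<dots> \<le> \<epsilon> * depth_mass B * exp (C * s)"
        using calculation s par by (intro mult_le_cancel_left1[THEN iffD2]) (auto simp: C_def)
      finally have "1 < \<epsilon> * exp (C * s) * depth_mass B" by (simp add: mult_ac)
      moreover have "u s B \<le> 1" using u_le_1 s B by auto
      moreover have "exp (- \<delta> * s) * \<rho> ^ card B > 0" using \<rho>0 by simp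
      ultimately show "w s B > 0" unfolding w_def by linarith
    next
      fix s :: real and B assume s: "0 \<le> s" and B: "B \<in> S" and zero: "w s B = 0"
        and nonneg: "\<And>B'. B' \<in> S \<Longrightarrow> w s B' \<ge> 0"
      let ?v = "exp (- \<delta> * s)" and ?h = "\<epsilon> * exp (C * s)"
      have B': "finite B" "B \<noteq> {}" "B \<subseteq> tree_vert N" using B by (auto simp: S_def)
      have "0 \<le> dual_gen N lam th (w s) B"
        using B' par zero nonneg by (intro dual_gen_nonneg) (auto simp: S_def)
      also have "\<dots> = ?v * dual_gen N lam th (\<lambda>B. \<rho> ^ card B) B + ?h * dual_gen N lam th depth_mass B
         - dual_gen N lam th (u s) B"
        unfolding w_def dual_gen_diff dual_gen_add dual_gen_cmult ..
      also have "?v * dual_gen N lam th (\<lambda>B. \<rho> ^ card B) B \<le> ?v * (- \<delta> * \<rho> ^ card B)"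
        unfolding \<delta>_def using B' par \<rho> \<rho>0 by (intro mult_left_mono dual_gen_power_card_le) auto
      also have "?h * dual_gen N lam th depth_mass B \<le> ?h * (2 * lam * depth_mass B)"
        using B' par \<epsilon> by (intro mult_left_mono dual_gen_depth_mass_le) auto
      also have "?h * (2 * lam * depth_mass B) < C * (?h * depth_mass B)"
        using depth_mass_ge_1[OF B'(1,2)] \<epsilon> by (simp add: C_def algebra_simps)
      finally show "D s B > 0" by (simp add: D_def algebra_simps)
    qed (use A \<open>0 \<le> t\<close> in \<open>auto simp: S_def\<close>)
    then show ?thesis by (simp add: w_def mult.assoc)
  qed
  have "u t A \<le> exp (- \<delta> * t) * \<rho> ^ card A"
  proof (rule field_le_epsilon)
    fix e :: real assume "e > 0"
    moreover have pos: "exp (C * t) * depth_mass A > 0" using depth_mass_ge_1[OF A(1,2)] by simp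
    ultimately have "u t A < exp (- \<delta> * t) * \<rho> ^ card A
        + e / (exp (C * t) * depth_mass A) * (exp (C * t) * depth_mass A)"
      by (intro approx divide_pos_pos)
    also have "e / (exp (C * t) * depth_mass A) * (exp (C * t) * depth_mass A) = e"
      using pos by (metis less_numeral_extra(3) nonzero_eq_divide_eq)
    finally show "u t A \<le> exp (- \<delta> * t) * \<rho> ^ card A + e" by simp
  qed
  then show ?thesis by (simp add: u_def \<delta>_def)
qed

lemma void_prob_tendsto_0:
  assumes law: "bias_voter_law N lam th p \<mu>"
    and par: "0 < th" "th < lam" "N \<ge> 2" "0 < p" "p < 1" "lam / th > (real N + 1) / (real N - 1)"
    and x: "x \<in> tree_vert N"
  shows "((\<lambda>t. \<integral>\<eta>. zero_on {x} \<eta> \<partial>\<mu> t) \<longlongrightarrow> 0) at_top"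
proof -
  define b where "b = (lam - th) * (real N - 1)"
  define \<rho> where "\<rho> = max (1 - p) ((1 + 2 * th / b) / 2)"
  have "lam * (real N - 1) > th * (real N + 1)" using par by (simp add: field_simps)
  then have b: "2 * th < b" by (simp add: b_def algebra_simps)
  then have b0: "b > 0" using par by simp
  have q: "2 * th / b < 1" using b b0 by simp
  have \<rho>: "1 - p \<le> \<rho>" "\<rho> < 1" "2 * th / b < \<rho>" "0 < \<rho>"
    using q par unfolding \<rho>_def less_max_iff_disj by auto
  have drift: "2 * th / \<rho> < b" using \<rho>(3,4) b0 by (simp add: field_simps)
  define \<delta> where "\<delta> = (1 - \<rho>) / real (Suc N) * (b - 2 * th / \<rho>)"
  have \<delta>: "\<delta> > 0" unfolding \<delta>_def using drift \<rho> by (intro mult_pos_pos divide_pos_pos) auto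
  have bound: "(\<integral>\<eta>. zero_on {x} \<eta> \<partial>\<mu> t) \<le> exp (- \<delta> * t) * \<rho>" if "0 \<le> t" for t
    using void_prob_decay[OF law par(1-5) \<rho>(1,2), of "{x}" t] drift x that
    by (simp add: b_def \<delta>_def)
  show ?thesis
  proof (rule tendsto_sandwich)
    show "\<forall>\<^sub>F t in at_top. 0 \<le> (\<integral>\<eta>. zero_on {x} \<eta> \<partial>\<mu> t)"
      by (intro always_eventually allI Bochner_Integration.integral_nonneg) (simp add: zero_on_bounds)
    show "\<forall>\<^sub>F t in at_top. (\<integral>\<eta>. zero_on {x} \<eta> \<partial>\<mu> t) \<le> exp (- \<delta> * t) * \<rho>"
      using eventually_ge_at_top[of 0] by eventually_elim (rule bound)
    show "((\<lambda>t. exp (- \<delta> * t) * \<rho>) \<longlongrightarrow> 0) at_top" using \<delta> by real_asymp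
  qed simp
qed

section \<open>Weak convergence to the all-ones configuration\<close>

lemma topspace_conf_top: "topspace (conf_top N) = space (conf_space N)"
  by (simp add: conf_top_def conf_space_def space_PiM)

lemma continuous_conf_bounded:
  assumes "continuous_map (conf_top N) euclideanreal f"
  obtains B where "\<And>\<eta>. \<eta> \<in> space (conf_space N) \<Longrightarrow> \<bar>f \<eta>\<bar> \<le> B"
proof -
  have "compact_space (conf_top N)"
    unfolding conf_top_def by (simp add: compact_space_product_topology compact_space_discrete_topology)
  then have "compactin euclideanreal (f ` topspace (conf_top N))"
    using assms image_compactin compact_space_def by blast
  then have "bounded (f ` space (conf_space N))"
    by (simp add: topspace_conf_top compact_imp_bounded)
  then show thesis using that by (auto simp: bounded_real)
qed

lemma continuous_conf_local:
  assumes f: "continuous_map (conf_top N) euclideanreal f" and \<xi>: "\<xi> \<in> space (conf_space N)" and "e > 0"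
  obtains F where "finite F" "F \<subseteq> tree_vert N"
    "\<And>\<eta>. \<eta> \<in> space (conf_space N) \<Longrightarrow> (\<And>x. x \<in> F \<Longrightarrow> \<eta> x = \<xi> x) \<Longrightarrow> \<bar>f \<eta> - f \<xi>\<bar> < e"
proof -
  have "openin (conf_top N) {\<eta> \<in> topspace (conf_top N). f \<eta> \<in> ball (f \<xi>) e}"
    by (rule openin_continuous_map_preimage[OF f]) simp
  moreover have "\<xi> \<in> {\<eta> \<in> topspace (conf_top N). f \<eta> \<in> ball (f \<xi>) e}"
    using \<xi> \<open>e > 0\<close> by (simp add: topspace_conf_top)
  ultimately obtain U where U: "finite {x \<in> tree_vert N. U x \<noteq> UNIV}" "\<xi> \<in> Pi\<^sub>E (tree_vert N) U"
    "Pi\<^sub>E (tree_vert N) U \<subseteq> {\<eta> \<in> topspace (conf_top N). f \<eta> \<in> ball (f \<xi>) e}"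
    unfolding conf_top_def openin_product_topology_alt topspace_discrete_topology by meson
  show thesis
  proof (rule that[OF U(1)])
    fix \<eta> assume \<eta>: "\<eta> \<in> space (conf_space N)" "\<And>x. x \<in> {x \<in> tree_vert N. U x \<noteq> UNIV} \<Longrightarrow> \<eta> x = \<xi> x"
    have "\<eta> x \<in> U x" if "x \<in> tree_vert N" for x
      using \<eta>(2)[of x] U(2) that by (cases "U x = UNIV") (auto simp: PiE_iff)
    then have "\<eta> \<in> Pi\<^sub>E (tree_vert N) U" using \<eta>(1) by (auto simp: conf_space_def space_PiM PiE_iff)
    with U(3) show "\<bar>f \<eta> - f \<xi>\<bar> < e" by (auto simp: dist_real_def abs_minus_commute)
  qed auto
qed

lemma continuous_conf_measurable:
  assumes f: "continuous_map (conf_top N) euclideanreal f"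
  shows "f \<in> borel_measurable (conf_space N)"
proof -
  \<comment> \<open>The function is the pointwise limit of its values on configurations that are frozen
    to state 1 outside a growing finite set; each approximant is a cylinder function.\<close>
  define F where "F n = {x \<in> tree_vert N. length x \<le> n}" for n
  define r where "r n \<eta> = (\<lambda>x\<in>tree_vert N. x \<in> F n \<longrightarrow> \<eta> x)" for n and \<eta> :: "nat list \<Rightarrow> bool"
  have finF: "finite (F n)" for n
    by (rule finite_subset[OF _ finite_lists_length_le[of "{..N}" n]]) (auto simp: F_def tree_vert_def)
  have r_space: "r n \<eta> \<in> space (conf_space N)" for n \<eta>
    by (simp add: r_def conf_space_def space_PiM)
  define R where "R n = (\<lambda>B. \<lambda>x\<in>tree_vert N. x \<in> F n \<longrightarrow> x \<in> B) ` Pow (F n)" for n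
  have "(\<lambda>\<eta>. f (r n \<eta>)) \<in> borel_measurable (conf_space N)" for n
  proof -
    have "r n \<in> measurable (conf_space N) (count_space (R n))"
    proof (subst measurable_count_space_eq2, simp add: R_def finF, intro conjI ballI Pi_I)
      fix \<eta>
      show "r n \<eta> \<in> R n"
        unfolding R_def by (rule image_eqI[of _ _ "{x \<in> F n. \<eta> x}"]) (auto simp: r_def restrict_def)
    next
      fix \<zeta> assume "\<zeta> \<in> R n"
      then obtain B where \<zeta>: "\<zeta> = (\<lambda>x\<in>tree_vert N. x \<in> F n \<longrightarrow> x \<in> B)" "B \<subseteq> F n"
        by (auto simp: R_def)
      have "r n -` {\<zeta>} \<inter> space (conf_space N) = {\<eta> \<in> space (conf_space N). \<forall>x\<in>F n. \<eta> x = (x \<in> B)}"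
        unfolding \<zeta>(1) r_def by (auto simp: fun_eq_iff restrict_def F_def)
      also have "\<dots> \<in> sets (conf_space N)"
      proof (rule sets.sets_Collect_finite_All'[OF _ finF])
        fix x assume "x \<in> F n"
        then have "x \<in> tree_vert N" by (simp add: F_def)
        from measurable_sets[OF measurable_coord[OF this], of "{x \<in> B}"]
        have "(\<lambda>\<eta>. \<eta> x) -` {x \<in> B} \<inter> space (conf_space N) \<in> sets (conf_space N)" by simp
        also have "(\<lambda>\<eta>. \<eta> x) -` {x \<in> B} \<inter> space (conf_space N) = {\<eta> \<in> space (conf_space N). \<eta> x = (x \<in> B)}"
          by auto
        finally show "{\<eta> \<in> space (conf_space N). \<eta> x = (x \<in> B)} \<in> sets (conf_space N)" .
      next
        have "[] \<in> F n" by (simp add: F_def tree_vert_def)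
        then show "F n \<noteq> {}" by blast
      qed
      finally show "r n -` {\<zeta>} \<inter> space (conf_space N) \<in> sets (conf_space N)" .
    qed
    then show ?thesis by (rule measurable_compose) simp
  qed
  moreover have "(\<lambda>n. f (r n \<eta>)) \<longlonglongrightarrow> f \<eta>" if \<eta>: "\<eta> \<in> space (conf_space N)" for \<eta>
  proof (rule LIMSEQ_I)
    fix e :: real assume "e > 0"
    from continuous_conf_local[OF f \<eta> this] obtain G where G: "finite G" "G \<subseteq> tree_vert N"
      "\<And>\<zeta>. \<zeta> \<in> space (conf_space N) \<Longrightarrow> (\<And>x. x \<in> G \<Longrightarrow> \<zeta> x = \<eta> x) \<Longrightarrow> \<bar>f \<zeta> - f \<eta>\<bar> < e" by blast
    obtain n0 where n0: "\<And>x. x \<in> G \<Longrightarrow> length x \<le> n0"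
      using finite_nat_set_iff_bounded_le[of "length ` G"] G(1) by auto
    have "\<bar>f (r n \<eta>) - f \<eta>\<bar> < e" if "n \<ge> n0" for n
    proof (rule G(3)[OF r_space])
      fix x assume "x \<in> G"
      then have "x \<in> F n" using n0[of x] G(2) that by (auto simp: F_def)
      then show "r n \<eta> x = \<eta> x" by (simp add: r_def F_def)
    qed
    then show "\<exists>n0. \<forall>n\<ge>n0. norm (f (r n \<eta>) - f \<eta>) < e" by auto
  qed
  ultimately show ?thesis by (rule borel_measurable_LIMSEQ_metric)
qed

lemma weak_conv_to_all_ones:
  assumes M: "\<And>t. 0 \<le> t \<Longrightarrow> prob_space (\<mu> t)" "\<And>t. 0 \<le> t \<Longrightarrow> sets (\<mu> t) = sets (conf_space N)"
    and void: "\<And>x. x \<in> tree_vert N \<Longrightarrow> ((\<lambda>t. \<integral>\<eta>. zero_on {x} \<eta> \<partial>\<mu> t) \<longlongrightarrow> 0) at_top"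
  shows "weak_conv_to N \<mu> (all_ones N)"
  unfolding weak_conv_to_def
proof (intro allI impI)
  fix f assume f: "continuous_map (conf_top N) euclideanreal f"
  let ?one = "all_ones N"
  have one: "?one \<in> space (conf_space N)" by (simp add: all_ones_def conf_space_def space_PiM)
  obtain B where B: "\<And>\<eta>. \<eta> \<in> space (conf_space N) \<Longrightarrow> \<bar>f \<eta>\<bar> \<le> B"
    using continuous_conf_bounded[OF f] by blast
  have B0: "B \<ge> 0" using B[OF one] by linarith
  show "((\<lambda>t. \<integral>\<eta>. f \<eta> \<partial>\<mu> t) \<longlongrightarrow> f ?one) at_top"
  proof (rule tendstoI)
    fix e :: real assume "e > 0"
    then have "e / 2 > 0" by simp
    from continuous_conf_local[OF f one this] obtain F where F: "finite F" "F \<subseteq> tree_vert N"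
      "\<And>\<eta>. \<eta> \<in> space (conf_space N) \<Longrightarrow> (\<And>x. x \<in> F \<Longrightarrow> \<eta> x = ?one x) \<Longrightarrow> \<bar>f \<eta> - f ?one\<bar> < e / 2" by blast
    have pointwise: "\<bar>f \<eta> - f ?one\<bar> \<le> e / 2 + 2 * B * (\<Sum>x\<in>F. zero_on {x} \<eta>)"
      if \<eta>: "\<eta> \<in> space (conf_space N)" for \<eta>
    proof (cases "\<forall>x\<in>F. \<eta> x")
      case True
      then have "\<bar>f \<eta> - f ?one\<bar> < e / 2" using F(2) \<eta> by (intro F(3)) (auto simp: all_ones_def)
      moreover have "0 \<le> 2 * B * (\<Sum>x\<in>F. zero_on {x} \<eta>)"
        using B0 by (intro mult_nonneg_nonneg sum_nonneg) (auto simp: zero_on_bounds)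
      ultimately show ?thesis by linarith
    next
      case False
      then obtain x where x: "x \<in> F" "\<not> \<eta> x" by auto
      have "zero_on {x} \<eta> \<le> (\<Sum>x\<in>F. zero_on {x} \<eta>)"
        using x F(1) by (intro member_le_sum) (auto simp: zero_on_bounds)
      then have "1 \<le> (\<Sum>x\<in>F. zero_on {x} \<eta>)" using x by (simp add: zero_on_def)
      then have "2 * B * 1 \<le> 2 * B * (\<Sum>x\<in>F. zero_on {x} \<eta>)" using B0 by (intro mult_left_mono) auto
      moreover have "\<bar>f \<eta> - f ?one\<bar> \<le> 2 * B" using B[OF \<eta>] B[OF one] by linarith
      ultimately show ?thesis using \<open>e > 0\<close> by linarith
    qed
    have bound: "\<bar>(\<integral>\<eta>. f \<eta> \<partial>\<mu> t) - f ?one\<bar> \<le> e / 2 + 2 * B * (\<Sum>x\<in>F. \<integral>\<eta>. zero_on {x} \<eta> \<partial>\<mu> t)"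
      if "0 \<le> t" for t
    proof -
      note Mt = M(1)[OF that] M(2)[OF that]
      interpret prob_space "\<mu> t" by (rule Mt)
      have sp: "space (\<mu> t) = space (conf_space N)" by (rule sets_eq_imp_space_eq[OF Mt(2)])
      have "f \<in> borel_measurable (\<mu> t)"
        using continuous_conf_measurable[OF f] measurable_cong_sets[OF Mt(2) refl] by blast
      then have int_f: "integrable (\<mu> t) f"
        using B by (intro integrable_const_bound[where B = B]) (auto simp: sp)
      have int_z: "integrable (\<mu> t) (zero_on {x})" if "x \<in> F" for x
        using that F by (intro zero_on_integrable[OF Mt]) auto
      have "(\<integral>\<eta>. f \<eta> \<partial>\<mu> t) - f ?one = (\<integral>\<eta>. f \<eta> - f ?one \<partial>\<mu> t)"
        using int_f by (simp add: prob_space)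
      also have "\<bar>\<dots>\<bar> \<le> (\<integral>\<eta>. \<bar>f \<eta> - f ?one\<bar> \<partial>\<mu> t)" by (rule integral_abs_bound)
      also have "\<dots> \<le> (\<integral>\<eta>. e / 2 + 2 * B * (\<Sum>x\<in>F. zero_on {x} \<eta>) \<partial>\<mu> t)"
        using int_f int_z pointwise by (intro integral_mono) (auto simp: sp)
      also have "\<dots> = e / 2 + 2 * B * (\<Sum>x\<in>F. \<integral>\<eta>. zero_on {x} \<eta> \<partial>\<mu> t)"
        using int_z by (simp add: prob_space)
      finally show ?thesis .
    qed
    have "((\<lambda>t. e / 2 + 2 * B * (\<Sum>x\<in>F. \<integral>\<eta>. zero_on {x} \<eta> \<partial>\<mu> t)) \<longlongrightarrow> e / 2 + 2 * B * (\<Sum>x\<in>F. 0)) at_top"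
      using F(2) by (intro tendsto_intros void) auto
    then have "\<forall>\<^sub>F t in at_top. e / 2 + 2 * B * (\<Sum>x\<in>F. \<integral>\<eta>. zero_on {x} \<eta> \<partial>\<mu> t) < e"
      using \<open>e > 0\<close> by (elim order_tendstoD) simp
    then show "\<forall>\<^sub>F t in at_top. dist (\<integral>\<eta>. f \<eta> \<partial>\<mu> t) (f ?one) < e"
      using eventually_ge_at_top[of 0]
    proof eventually_elim
      case (elim t)
      then show ?case using bound[of t] by (simp add: dist_real_def)
    qed
  qed
qed

theorem theorem2p2:
  shows "\<exists>A :: nat \<Rightarrow> real.
    (\<forall>N\<ge>2. A N > 0 \<and>
      (\<forall>lam th. 0 < th \<longrightarrow> th < lam \<longrightarrow> lam / th > A N \<longrightarrow>
        (\<forall>p. 0 < p \<longrightarrow> p < 1 \<longrightarrow>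
          (\<forall>\<mu>. bias_voter_law N lam th p \<mu> \<longrightarrow> weak_conv_to N \<mu> (all_ones N))))) \<and>
    limsup (\<lambda>N. ereal (A N / sqrt (real N))) \<le> 1"
proof (intro exI[of _ "\<lambda>N. (real N + 1) / (real N - 1)"] conjI allI impI)
  fix N :: nat assume "N \<ge> 2"
  then show "(real N + 1) / (real N - 1) > 0" by simp
next
  fix N :: nat and lam th p :: real and \<mu>
  assume "N \<ge> 2" "0 < th" "th < lam" "lam / th > (real N + 1) / (real N - 1)" "0 < p" "p < 1"
    and law: "bias_voter_law N lam th p \<mu>"
  then show "weak_conv_to N \<mu> (all_ones N)"
    by (intro weak_conv_to_all_ones void_prob_tendsto_0[OF law]) (auto simp: bias_voter_law_def)
next
  have "(\<lambda>N. (real N + 1) / (real N - 1) / sqrt (real N)) \<longlonglongrightarrow> 0"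
    by real_asymp
  then have "(\<lambda>N. ereal ((real N + 1) / (real N - 1) / sqrt (real N))) \<longlonglongrightarrow> ereal 0"
    by (rule tendsto_ereal)
  then have "limsup (\<lambda>N. ereal ((real N + 1) / (real N - 1) / sqrt (real N))) = ereal 0"
    by (intro lim_imp_Limsup) auto
  then show "limsup (\<lambda>N. ereal ((real N + 1) / (real N - 1) / sqrt (real N))) \<le> 1" by simp
qed

end
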